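(* Let $k\ge 1$ and let $L_2^k$ be the incidence structure defined as follows. Its points are a special point $D$ together with points $a_g, b_g, c_g$ for $g \in \mathbb{F}_2^k$. Its lines are the three special lines $A=\{a_g : g\in\mathbb{F}_2^k\}\cup\{D\}$, $B=\{b_g : g\in\mathbb{F}_2^k\}\cup\{D\}$, $C=\{c_g : g\in\mathbb{F}_2^k\}\cup\{D\}$, and the ordinary lines $\{a_g, b_{g+h}, c_h\}$ for $g,h\in\mathbb{F}_2^k$. Then the graph of lines of $L_2^k$ (vertices: the ordinary lines; two ordinary lines adjacent iff they share a point) is isomorphic to the bilinear forms graph $H_2(2,k)$.
   Context: For a prime power $q$ and positive integer $k$, the bilinear forms graph $H_q(2,k)$ has as vertices all $2\times k$ matrices over the field $\mathbb{F}_q$, two matrices being adjacent iff their difference has rank $1$. *)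

theory Defs
  imports
    "HOL-Analysis.Analysis"
    "HOL-Library.Z2"
    "Graph_Theory.Graph_Theory"
begin

text \<open>
  The field with two elements is \<^typ>\<open>bit\<close>, and \<open>\<bbbF>\<^sub>2\<^sup>k\<close> is \<open>bit ^ 'k\<close> with \<open>k = CARD('k)\<close>.
  Undirected simple graphs are symmetric loop-free pair digraphs: an edge is represented by its
  two arcs.
\<close>

instance bit :: finite
proof
  have "(UNIV :: bit set) \<subseteq> {0, 1}"
    using bit_not_zero_iff by auto
  then show "finite (UNIV :: bit set)"
    by (rule finite_subset) simp
qed

definition bilinear_forms_graph :: "('q::{field,finite} ^ 'k ^ 2) pair_pre_digraph" where
  "bilinear_forms_graph = \<lparr> pverts = UNIV, parcs = {(M, N). rank (M - N) = 1} \<rparr>"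

record 'p incidence_structure =
  points :: "'p set"
  special_lines :: "'p set set"
  ordinary_lines :: "'p set set"

definition graph_of_lines :: "'p incidence_structure \<Rightarrow> 'p set pair_pre_digraph" where
  "graph_of_lines L =
    \<lparr> pverts = ordinary_lines L,
      parcs = {(l, m). l \<in> ordinary_lines L \<and> m \<in> ordinary_lines L \<and> l \<noteq> m \<and> l \<inter> m \<noteq> {}} \<rparr>"

datatype 'g L_point = pt_D | pt_a 'g | pt_b 'g | pt_c 'g

definition L2 :: "(bit ^ 'k) L_point incidence_structure" where
  "L2 =
    \<lparr> points = {pt_D} \<union> range pt_a \<union> range pt_b \<union> range pt_c,
      special_lines = {range pt_a \<union> {pt_D}, range pt_b \<union> {pt_D}, range pt_c \<union> {pt_D}},
      ordinary_lines = {{pt_a g, pt_b (g + h), pt_c h} | g h. True} \<rparr>"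

end

theory Submission
  imports Defs
begin

text \<open>
  Send the matrix with rows \<open>g\<close> and \<open>h\<close> to the ordinary line \<open>{a\<^sub>g, b\<^bsub>g+h\<^esub>, c\<^sub>h}\<close>. Two such
  lines meet iff their matrices agree in the first row, in the second row, or in the sum of the
  rows. Since the only nonzero scalar of \<open>\<bbbF>\<^sub>2\<close> is \<open>1\<close>, these are exactly the three ways in which the
  two rows of the difference matrix can be linearly dependent.
\<close>

lemma digraph_iso_with_projI:
  assumes wf_G: "pair_wf_digraph G" and wf_H: "pair_wf_digraph H"
    and bij: "bij_betw f (pverts G) (pverts H)"
    and arcs_iff: "\<And>u v. u \<in> pverts G \<Longrightarrow> v \<in> pverts G \<Longrightarrow>
      (f u, f v) \<in> parcs H \<longleftrightarrow> (u, v) \<in> parcs G"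
  shows "digraph_iso (with_proj G) (with_proj H)"
proof -
  interpret G: pair_wf_digraph G by (rule wf_G)
  interpret H: pair_wf_digraph H by (rule wf_H)
  let ?hom = "\<lparr>iso_verts = f, iso_arcs = map_prod f f, iso_head = snd, iso_tail = fst\<rparr>"
  have inj: "inj_on f (pverts G)" and img: "f ` pverts G = pverts H"
    using bij by (auto simp: bij_betw_def)
  have parcs_subset: "parcs G \<subseteq> pverts G \<times> pverts G"
    by (auto dest: G.wellformed')
  have inj_arcs: "inj_on (map_prod f f) (parcs G)"
    using map_prod_inj_on[OF inj inj] parcs_subset by (rule inj_on_subset)
  have "map_prod f f ` parcs G = parcs H"
  proof
    show "map_prod f f ` parcs G \<subseteq> parcs H"
      using parcs_subset arcs_iff by auto
    show "parcs H \<subseteq> map_prod f f ` parcs G"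
    proof (rule subrelI)
      fix x y assume xy: "(x, y) \<in> parcs H"
      then have "x \<in> f ` pverts G" "y \<in> f ` pverts G"
        unfolding img by (auto dest: H.wellformed')
      then obtain u v where "u \<in> pverts G" "v \<in> pverts G" "x = f u" "y = f v"
        by blast
      with xy arcs_iff show "(x, y) \<in> map_prod f f ` parcs G"
        by (auto intro!: image_eqI[where x = "(u, v)"])
    qed
  qed
  then have "with_proj H = app_iso ?hom (with_proj G)"
    by (simp add: app_iso_def with_proj_def img)
  moreover have "G.digraph_isomorphism ?hom"
    using inj inj_arcs G.wf_digraph_axioms by (auto simp: G.digraph_isomorphism_def)
  ultimately show ?thesis
    unfolding digraph_iso_def by blast
qed

lemma pair_wf_digraph_graph_of_lines: "pair_wf_digraph (graph_of_lines L)"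
  by unfold_locales (auto simp: graph_of_lines_def)

lemma pair_wf_digraph_bilinear_forms_graph: "pair_wf_digraph bilinear_forms_graph"
  by unfold_locales (auto simp: bilinear_forms_graph_def)

lemma vec_2_eq_iff: "v = w \<longleftrightarrow> v $ 1 = w $ 1 \<and> v $ 2 = w $ 2" for v w :: "'a ^ 2"
  by (simp add: vec_eq_iff forall_2)

lemma rows_2: "rows M = {M $ 1, M $ 2}" for M :: "'a ^ 'n ^ 2"
  by (auto simp: rows_def row_def UNIV_2)

lemma rank_2_rows_eq_1_iff:
  fixes M :: "'a::field ^ 'n ^ 2"
  shows "rank M = 1 \<longleftrightarrow> M \<noteq> 0 \<and> (M $ 1 = 0 \<or> M $ 2 \<in> vec.span {M $ 1})"
proof -
  have "rank M = vec.dim {M $ 2, M $ 1}"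
    by (simp add: row_rank_def_gen rows_2 insert_commute)
  then show ?thesis
    by (auto simp: vec.dim_insert vec_2_eq_iff[of M])
qed

lemma UNIV_bit: "(UNIV :: bit set) = {0, 1}"
  using bit_not_zero_iff by auto

lemma span_singleton_bit: "vec.span {v} = {0, v}" for v :: "bit ^ 'n"
  by (simp add: vec.span_singleton UNIV_bit)

lemma rank_bit_2_rows_eq_1_iff:
  fixes M :: "bit ^ 'n ^ 2"
  shows "rank M = 1 \<longleftrightarrow> M \<noteq> 0 \<and> (M $ 1 = 0 \<or> M $ 2 = 0 \<or> M $ 1 = M $ 2)"
  unfolding rank_2_rows_eq_1_iff span_singleton_bit by auto

lemma uminus_vec_bit: "- v = v" for v :: "bit ^ 'n"
  by (simp add: vec_eq_iff)

lemma add_eq_add_iff_diff_eq_diff_vec_bit: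
  fixes u v x y :: "bit ^ 'n"
  shows "u + v = x + y \<longleftrightarrow> u - x = v - y"
proof -
  have "u + v = x + y \<longleftrightarrow> u - x = - (v - y)"
    by (auto simp: algebra_simps)
  then show ?thesis
    by (simp only: uminus_vec_bit)
qed

definition ordinary_line :: "'g::plus ^ 2 \<Rightarrow> 'g L_point set" where
  "ordinary_line M = {pt_a (M $ 1), pt_b (M $ 1 + M $ 2), pt_c (M $ 2)}"

lemma ordinary_line_eq_iff: "ordinary_line M = ordinary_line N \<longleftrightarrow> M = N"
  by (auto simp: ordinary_line_def vec_2_eq_iff doubleton_eq_iff)

lemma ordinary_lines_meet_iff:
  "ordinary_line M \<inter> ordinary_line N \<noteq> {} \<longleftrightarrow>
    M $ 1 = N $ 1 \<or> M $ 2 = N $ 2 \<or> M $ 1 + M $ 2 = N $ 1 + N $ 2"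
  by (auto simp: ordinary_line_def)

lemma range_ordinary_line: "range ordinary_line = ordinary_lines L2"
proof -
  have "ordinary_line (vector [g, h]) = {pt_a g, pt_b (g + h), pt_c h}" for g h :: "bit ^ 'k"
    by (simp add: ordinary_line_def)
  then have "{pt_a g, pt_b (g + h), pt_c h} \<in> range ordinary_line" for g h :: "bit ^ 'k"
    by (metis rangeI)
  then show ?thesis
    by (auto simp: L2_def ordinary_line_def)
qed

lemma bij_betw_ordinary_line: "bij_betw ordinary_line UNIV (ordinary_lines L2)"
  by (simp add: bij_betw_def inj_def ordinary_line_eq_iff range_ordinary_line)

lemma ordinary_lines_adjacent_iff:
  fixes M N :: "bit ^ 'k ^ 2"
  shows "ordinary_line M \<noteq> ordinary_line N \<and> ordinary_line M \<inter> ordinary_line N \<noteq> {} \<longleftrightarrow>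
    rank (M - N) = 1"
  unfolding ordinary_line_eq_iff ordinary_lines_meet_iff rank_bit_2_rows_eq_1_iff
    add_eq_add_iff_diff_eq_diff_vec_bit by simp

theorem theorem4p2:
  shows "digraph_iso
    (with_proj (graph_of_lines (L2 :: (bit ^ 'k) L_point incidence_structure)))
    (with_proj (bilinear_forms_graph :: (bit ^ 'k ^ 2) pair_pre_digraph))"
    (is "digraph_iso (with_proj ?L) (with_proj ?H)")
proof (rule digraph_iso_swap)
  show "wf_digraph (with_proj ?H)"
    by (simp add: wf_digraph_wp_iff pair_wf_digraph_bilinear_forms_graph)
  show "digraph_iso (with_proj ?H) (with_proj ?L)"
  proof (rule digraph_iso_with_projI)
    show "bij_betw ordinary_line (pverts ?H) (pverts ?L)"
      using bij_betw_ordinary_line by (simp add: bilinear_forms_graph_def graph_of_lines_def)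
    show "(ordinary_line M, ordinary_line N) \<in> parcs ?L \<longleftrightarrow> (M, N) \<in> parcs ?H" for M N
      using ordinary_lines_adjacent_iff[of M N]
      by (simp add: bilinear_forms_graph_def graph_of_lines_def flip: range_ordinary_line)
  qed (fact pair_wf_digraph_bilinear_forms_graph pair_wf_digraph_graph_of_lines)+
qed

end
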